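(* Consider the $K$-user OFDMA system with birth-death queue transition kernel described in the context, let $\widetilde V:\{0,\dots,N_Q\}^K\to\mathbb R$ be the current potential, and put $\Delta_k\widetilde V(\mathbf Q)=\widetilde V(Q_1,\dots,Q_K)-\widetilde V(Q_1,\dots,[Q_k-1]^+,\dots,Q_K)$. Then the optimizing power control and subcarrier allocation actions in the policy improvement step $\Omega=\arg\min\mathbf T(\widetilde{\mathbf V})$ for given CSI $\mathbf H$ and QSI $\mathbf Q$ are given by $$p_{k,n}(\mathbf H,\mathbf Q)=s_{k,n}(\mathbf H,\mathbf Q)\Bigl(\frac{\frac{\tau}{\overline N_k}\Delta_k\widetilde V(\mathbf Q)}{\gamma}-\frac1{|H_{k,n}|^2}\Bigr)^+,$$ $$s_{k,n}(\mathbf H,\mathbf Q)=\begin{cases}1,&\text{if }X_{k,n}=\max_j\{X_{j,n}\}>0\\0,&\text{otherwise,}\end{cases}$$ where $\gamma$ satisfies the average power constraint $\mathbb E_{\pi_{\boldsymbol\chi}}[\sum_{k,n}p_{k,n}]\le P_0$ and $$X_{k,n}=\frac{\tau}{\overline N_k}\Delta_k\widetilde V(\mathbf Q)\log\Bigl(1+|H_{k,n}|^2\Bigl(\frac{\frac{\tau}{\overline N_k}\Delta_k\widetilde V(\mathbf Q)}{\gamma}-\frac1{|H_{k,n}|^2}\Bigr)^+\Bigr)-\gamma\Bigl(\frac{\frac{\tau}{\overline N_k}\Delta_k\widetilde V(\mathbf Q)}{\gamma}-\frac1{|H_{k,n}|^2}\Bigr)^+ .$$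
   Context: **System.** There are $K$ users, $N_F$ subcarriers and slots of duration $\tau$. The CSI $\mathbf H=\{H_{k,n}\}$ has entries $H_{k,n}\sim\mathcal{CN}(0,1)$ and is i.i.d. over slots. The joint queue state $\mathbf Q=(Q_1,\dots,Q_K)$ lies in $\{0,\dots,N_Q\}^K=\{\mathbf Q^1,\dots,\mathbf Q^I\}$, $I=(N_Q+1)^K$. Arrivals to queue $k$ are Poisson with rate $\lambda_k$, and packet sizes are exponential with mean $\overline N_k$; $\lambda_k\tau\ll1$, $\mu_k\tau\ll1$. The system state is $\boldsymbol\chi=(\mathbf H,\mathbf Q)$, with steady state distribution $\pi_{\boldsymbol\chi}$ under a given policy. An action consists of powers $p_{k,n}\ge0$ and subcarrier indicators $s_{k,n}\in\{0,1\}$ with $\sum_ks_{k,n}=1$ for each $n$; $\mathbf u(\mathbf Q)$ is the collection of actions at $(\mathbf H,\mathbf Q)$ over all $\mathbf H$. $\gamma>0$ is the Lagrange multiplier of the average transmit power constraint, and the reward is $\sum_k\beta_kQ_k/\lambda_k+\gamma\sum_{k,n}p_{k,n}$, $\beta_k>0$, with conditional expectation $\widetilde g(\mathbf Q,\mathbf u(\mathbf Q))$ given $\mathbf Q$. Notation: $x^+=[x]^+=\max\{x,0\}$, and $\log$ is the natural logarithm. **Kernel.** With $\overline\mu_k(\mathbf Q)=\mathbb E[\sum_ns_{k,n}\log(1+p_{k,n}|H_{k,n}|^2)\mid\mathbf Q]/\overline N_k$, the kernel $\widetilde f(\cdot\mid\mathbf Q,\mathbf u(\mathbf Q))$ assigns,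 for every $k$, mass $\lambda_k\tau$ to $(Q_1,\dots,\min\{Q_k+1,N_Q\},\dots,Q_K)$ and mass $\overline\mu_k(\mathbf Q)\tau$ to $(Q_1,\dots,(Q_k-1)^+,\dots,Q_K)$, and the remaining mass $1-\sum_k(\lambda_k\tau+\overline\mu_k(\mathbf Q)\tau)$ to $\mathbf Q$ (masses assigned to coinciding states are added). **Policy improvement step.** $\mathbf T$ has components $T_i(\widetilde{\mathbf V})=\min_{\mathbf u(\mathbf Q^i)}\{\widetilde g(\mathbf Q^i,\mathbf u(\mathbf Q^i))+\sum_{\mathbf Q^j}\widetilde f(\mathbf Q^j\mid\mathbf Q^i,\mathbf u(\mathbf Q^i))\widetilde V(\mathbf Q^j)\}$, and $\arg\min\mathbf T(\widetilde{\mathbf V})$ is the policy of minimizing actions. Up to terms not depending on the action, the objective at $\mathbf Q^i$ is $$\mathbb E\Bigl[\gamma\sum_{k,n}p_{k,n}-\sum_{k=1}^K\Delta_k\widetilde V(\mathbf Q^i)\frac{\tau}{\overline N_k}\sum_{n=1}^{N_F}s_{k,n}\log(1+p_{k,n}|H_{k,n}|^2)\,\Big|\,\mathbf Q^i\Bigr].$$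
   Formalization: For a.e. H: if max_j X=0, the displayed s=0 violates sum_k s=1, so s is asserted only where max_j X>0; the literal pair is optimal if idling is allowed. The s-formula and this optimality assume independent users (no ties); for any law, optimizers serve a user of maximal X. *)

theory Defs
  imports "HOL-Probability.Probability"
begin

text \<open>
  Users and subcarriers are indexed by finite types \<open>'k\<close> and \<open>'n\<close>, so \<open>K = CARD('k)\<close> and
  \<open>N_F = CARD('n)\<close>. A channel state has entries \<open>H $ k $ n\<close>.
\<close>

type_synonym ('k, 'n) csi = "complex ^ 'n ^ 'k"
type_synonym 'k qsi = "'k \<Rightarrow> nat"

text \<open>\<open>\<C>\<N>(0,1)\<close>: independent real and imaginary parts, each \<open>N(0,1/2)\<close>
  (\<open>normal_density\<close> takes the standard deviation).\<close>

definition complex_normal :: "complex measure" where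
  "complex_normal =
     distr (density lborel (\<lambda>x. ennreal (normal_density 0 (sqrt (1/2)) x)) \<Otimes>\<^sub>M
            density lborel (\<lambda>x. ennreal (normal_density 0 (sqrt (1/2)) x)))
       borel (\<lambda>(x, y). Complex x y)"

record ('k, 'n) action =
  tx_power :: "'k \<Rightarrow> 'n \<Rightarrow> real"
  sc_alloc :: "'k \<Rightarrow> 'n \<Rightarrow> real"

type_synonym ('k, 'n) rule = "('k, 'n) csi \<Rightarrow> ('k, 'n) action"
type_synonym ('k, 'n) policy = "'k qsi \<Rightarrow> ('k, 'n) rule"

record ('k :: finite, 'n :: finite) ofdma =
  csi_law :: "('k, 'n) csi measure"
  queue_cap :: nat
  slot_len :: real
  arr_rate :: "'k \<Rightarrow> real"
  pkt_mean :: "'k \<Rightarrow> real"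
  delay_weight :: "'k \<Rightarrow> real"
  multiplier :: real

definition ofdma_system :: "('k :: finite, 'n :: finite) ofdma \<Rightarrow> bool" where
  "ofdma_system S \<longleftrightarrow>
     prob_space (csi_law S) \<and> sets (csi_law S) = sets borel \<and>
     (\<forall>k n. distr (csi_law S) borel (\<lambda>H. H $ k $ n) = complex_normal) \<and>
     0 < slot_len S \<and> 0 < multiplier S \<and>
     (\<forall>k. 0 < arr_rate S k \<and> 0 < pkt_mean S k \<and> 0 < delay_weight S k)"

definition csi_indep_users :: "('k :: finite, 'n :: finite) ofdma \<Rightarrow> bool" where
  "csi_indep_users S \<longleftrightarrow>
     (\<forall>n. prob_space.indep_vars (csi_law S) (\<lambda>_. borel) (\<lambda>k H. H $ k $ n) UNIV)"

definition qstates :: "('k :: finite, 'n :: finite) ofdma \<Rightarrow> 'k qsi set" where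
  "qstates S = {Q. \<forall>k. Q k \<le> queue_cap S}"

definition actions :: "('k :: finite, 'n :: finite) action set" where
  "actions = {a. (\<forall>k n. 0 \<le> tx_power a k n \<and> sc_alloc a k n \<in> {0, 1}) \<and>
                 (\<forall>n. (\<Sum>k\<in>UNIV. sc_alloc a k n) = 1)}"

text \<open>The variant in which a subcarrier may also be left idle.\<close>

definition idle_actions :: "('k :: finite, 'n :: finite) action set" where
  "idle_actions = {a. (\<forall>k n. 0 \<le> tx_power a k n \<and> sc_alloc a k n \<in> {0, 1}) \<and>
                      (\<forall>n. (\<Sum>k\<in>UNIV. sc_alloc a k n) \<le> 1)}"

text \<open>
  The collections \<open>u(Q)\<close> of actions over all channel states. The power must have a finite
  mean, because \<open>integral\<^sup>L\<close> returns 0 on functions that are not integrable; the mean rates are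
  then finite as well. Channel states of probability 0 do not affect any of the means below.
\<close>

definition rules ::
  "('k :: finite, 'n :: finite) ofdma \<Rightarrow> ('k, 'n) action set \<Rightarrow> ('k, 'n) rule set" where
  "rules S A = {u.
     (\<forall>k n. (\<lambda>H. tx_power (u H) k n) \<in> borel_measurable (csi_law S) \<and>
            (\<lambda>H. sc_alloc (u H) k n) \<in> borel_measurable (csi_law S) \<and>
            integrable (csi_law S) (\<lambda>H. tx_power (u H) k n)) \<and>
     (AE H in csi_law S. u H \<in> A)}"

definition q_up :: "('k :: finite, 'n :: finite) ofdma \<Rightarrow> 'k qsi \<Rightarrow> 'k \<Rightarrow> 'k qsi" where
  "q_up S Q k = Q(k := min (Q k + 1) (queue_cap S))"

text \<open>Subtraction on \<^typ>\<open>nat\<close> truncates, as required by \<open>[Q\<^sub>k - 1]\<^sup>+\<close>.\<close>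

definition q_down :: "'k qsi \<Rightarrow> 'k \<Rightarrow> 'k qsi" where
  "q_down Q k = Q(k := Q k - 1)"

text \<open>
  The channel state is independent of the queue state in the same slot (it is i.i.d. over slots),
  so conditional expectations given \<open>Q\<close> are integrals against \<open>csi_law\<close>.
\<close>

definition mean_rate ::
  "('k :: finite, 'n :: finite) ofdma \<Rightarrow> ('k, 'n) rule \<Rightarrow> 'k \<Rightarrow> real" where
  "mean_rate S u k =
     (\<integral>H. (\<Sum>n\<in>UNIV. sc_alloc (u H) k n * ln (1 + tx_power (u H) k n * (cmod (H $ k $ n))\<^sup>2))
        \<partial>csi_law S) / pkt_mean S k"

text \<open>\<open>kernel S Q u Q'\<close> is the mass assigned to \<open>Q'\<close> from \<open>Q\<close>.\<close>

definition kernel ::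
  "('k :: finite, 'n :: finite) ofdma \<Rightarrow> 'k qsi \<Rightarrow> ('k, 'n) rule \<Rightarrow> 'k qsi \<Rightarrow> real" where
  "kernel S Q u Q' =
     (\<Sum>k\<in>UNIV. arr_rate S k * slot_len S * of_bool (Q' = q_up S Q k)
              + mean_rate S u k * slot_len S * of_bool (Q' = q_down Q k))
     + (1 - (\<Sum>k\<in>UNIV. arr_rate S k * slot_len S + mean_rate S u k * slot_len S))
         * of_bool (Q' = Q)"

definition mean_reward ::
  "('k :: finite, 'n :: finite) ofdma \<Rightarrow> 'k qsi \<Rightarrow> ('k, 'n) rule \<Rightarrow> real" where
  "mean_reward S Q u =
     (\<integral>H. (\<Sum>k\<in>UNIV. delay_weight S k * real (Q k) / arr_rate S k)
         + multiplier S * (\<Sum>k\<in>UNIV. \<Sum>n\<in>UNIV. tx_power (u H) k n) \<partial>csi_law S)"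

definition bellman_objective ::
  "('k :: finite, 'n :: finite) ofdma \<Rightarrow> ('k qsi \<Rightarrow> real) \<Rightarrow> 'k qsi \<Rightarrow> ('k, 'n) rule \<Rightarrow> real" where
  "bellman_objective S V Q u =
     mean_reward S Q u + (\<Sum>Q'\<in>qstates S. kernel S Q u Q' * V Q')"

definition bellman_T ::
  "('k :: finite, 'n :: finite) ofdma \<Rightarrow> ('k qsi \<Rightarrow> real) \<Rightarrow> 'k qsi \<Rightarrow> real" where
  "bellman_T S V Q = (INF u\<in>rules S actions. bellman_objective S V Q u)"

definition argmin_T ::
  "('k :: finite, 'n :: finite) ofdma \<Rightarrow> ('k qsi \<Rightarrow> real) \<Rightarrow> ('k, 'n) policy set" where
  "argmin_T S V =
     {\<Omega>. \<forall>Q\<in>qstates S. is_arg_min (bellman_objective S V Q) (\<lambda>u. u \<in> rules S actions) (\<Omega> Q)}"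

text \<open>
  Steady state of \<open>(H, Q)\<close>: in each slot \<open>H\<close> is a fresh sample, independent of the queue
  state, so the joint law is a product whose second factor is invariant under the queue kernel.
\<close>

definition steady_state ::
  "('k :: finite, 'n :: finite) ofdma \<Rightarrow> ('k, 'n) policy \<Rightarrow> (('k, 'n) csi \<times> 'k qsi) measure \<Rightarrow> bool"
  where
  "steady_state S \<Omega> \<pi> \<longleftrightarrow>
     (\<exists>q. set_pmf q \<subseteq> qstates S \<and>
          (\<forall>Q'\<in>qstates S. pmf q Q' = (\<Sum>Q\<in>qstates S. pmf q Q * kernel S Q (\<Omega> Q) Q')) \<and>
          \<pi> = csi_law S \<Otimes>\<^sub>M measure_pmf q)"

text \<open>The restriction to \<open>qstates\<close>, which has probability 1, ignores the meaningless values
  of a policy outside the state space.\<close>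

definition average_power ::
  "('k :: finite, 'n :: finite) ofdma \<Rightarrow> ('k, 'n) policy \<Rightarrow> (('k, 'n) csi \<times> 'k qsi) measure \<Rightarrow> real"
  where
  "average_power S \<Omega> \<pi> =
     (\<integral>x\<in>(UNIV \<times> qstates S).
        (\<Sum>k\<in>UNIV. \<Sum>n\<in>UNIV. tx_power (\<Omega> (snd x) (fst x)) k n) \<partial>\<pi>)"

definition \<Delta>V :: "('k qsi \<Rightarrow> real) \<Rightarrow> 'k qsi \<Rightarrow> 'k \<Rightarrow> real" where
  "\<Delta>V V Q k = V Q - V (q_down Q k)"

definition water_fill ::
  "('k :: finite, 'n :: finite) ofdma \<Rightarrow> ('k qsi \<Rightarrow> real) \<Rightarrow> 'k qsi \<Rightarrow> ('k, 'n) csi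
     \<Rightarrow> 'k \<Rightarrow> 'n \<Rightarrow> real" where
  "water_fill S V Q H k n =
     max ((slot_len S / pkt_mean S k * \<Delta>V V Q k) / multiplier S - 1 / (cmod (H $ k $ n))\<^sup>2) 0"

definition X_metric ::
  "('k :: finite, 'n :: finite) ofdma \<Rightarrow> ('k qsi \<Rightarrow> real) \<Rightarrow> 'k qsi \<Rightarrow> ('k, 'n) csi
     \<Rightarrow> 'k \<Rightarrow> 'n \<Rightarrow> real" where
  "X_metric S V Q H k n =
     slot_len S / pkt_mean S k * \<Delta>V V Q k
       * ln (1 + (cmod (H $ k $ n))\<^sup>2 * water_fill S V Q H k n)
     - multiplier S * water_fill S V Q H k n"

definition X_max ::
  "('k :: finite, 'n :: finite) ofdma \<Rightarrow> ('k qsi \<Rightarrow> real) \<Rightarrow> 'k qsi \<Rightarrow> ('k, 'n) csi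
     \<Rightarrow> 'n \<Rightarrow> real" where
  "X_max S V Q H n = Max (range (\<lambda>j. X_metric S V Q H j n))"

definition alloc_formula ::
  "('k :: finite, 'n :: finite) ofdma \<Rightarrow> ('k qsi \<Rightarrow> real) \<Rightarrow> 'k qsi \<Rightarrow> ('k, 'n) csi
     \<Rightarrow> 'k \<Rightarrow> 'n \<Rightarrow> real" where
  "alloc_formula S V Q H k n =
     (if X_metric S V Q H k n = X_max S V Q H n \<and> 0 < X_max S V Q H n then 1 else 0)"

definition formula_policy ::
  "('k :: finite, 'n :: finite) ofdma \<Rightarrow> ('k qsi \<Rightarrow> real) \<Rightarrow> ('k, 'n) policy" where
  "formula_policy S V Q H =
     \<lparr> tx_power = (\<lambda>k n. alloc_formula S V Q H k n * water_fill S V Q H k n),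
       sc_alloc = alloc_formula S V Q H \<rparr>"

end

theory Submission
  imports Defs
begin

text \<open>
  Up to terms that do not depend on the action, the Bellman objective is the expectation of a sum
  over subcarriers, so it can be minimised separately for each channel state. On a subcarrier,
  serving user \<open>k\<close> with power \<open>p\<close> is worth \<open>c ln (1 + g p) - \<gamma> p\<close> with gain \<open>g = |H\<^sub>k\<^sub>n|\<^sup>2\<close> and
  \<open>c = \<tau> \<Delta>\<^sub>kV / N\<^sub>k\<close>; the water-filling level is its unique maximiser and \<open>X\<close> its maximum. A rule
  therefore attains the minimum iff almost surely it water-fills and serves a user of maximal \<open>X\<close>.
  Positive values of \<open>X\<close> are strictly increasing in \<open>g\<close>, so a positive tie between two independent
  users confines one channel entry to a circle determined by the other, which has probability 0.
  Hence the maximiser is almost surely unique wherever the maximum is positive. Where the maximum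
  is 0 no user receives power, and it makes no difference who is served, if anyone.
\<close>

section \<open>Water-filling for one user on one subcarrier\<close>

definition water_level :: "real \<Rightarrow> real \<Rightarrow> real \<Rightarrow> real" where
  "water_level c \<gamma> g = max (c / \<gamma> - 1 / g) 0"

definition net_rate :: "real \<Rightarrow> real \<Rightarrow> real \<Rightarrow> real \<Rightarrow> real" where
  "net_rate c \<gamma> g p = c * ln (1 + g * p) - \<gamma> * p"

lemma water_level_nonneg: "0 \<le> water_level c \<gamma> g"
  by (simp add: water_level_def)

text \<open>Strict optimality comes from \<open>ln x < x - 1\<close> for
  \<open>x \<noteq> 1\<close>, without derivatives. \<open>c\<close> may be negative, as potential
  differences may be; the water level is then 0.\<close>

lemma net_rate_less_water_level:
  assumes "0 < \<gamma>" "0 < g" "0 \<le> p" "p \<noteq> water_level c \<gamma> g"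
  shows "net_rate c \<gamma> g p < net_rate c \<gamma> g (water_level c \<gamma> g)"
proof (cases "c / \<gamma> - 1 / g \<le> 0")
  case True
  then have w: "water_level c \<gamma> g = 0" by (simp add: water_level_def)
  with assms have "0 < p" by simp
  \<comment> \<open>\<open>g * c\<close> is the marginal value of power at power 0; if it does not
    exceed the price \<open>\<gamma>\<close>, no positive power pays.\<close>
  have gc: "g * c \<le> \<gamma>" using True assms by (simp add: field_simps)
  have "c * ln (1 + g * p) < \<gamma> * p"
  proof (cases "c \<le> 0")
    case True
    have "c * ln (1 + g * p) \<le> 0"
      using True assms by (intro mult_nonpos_nonneg) auto
    also have "0 < \<gamma> * p" using \<open>0 < p\<close> assms by simp
    finally show ?thesis .
  next
    case False
    have "0 < g * p" using \<open>0 < p\<close> assms by simp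
    then have "ln (1 + g * p) < g * p"
      using ln_le_minus_one[of "1 + g * p"] ln_eq_minus_one[of "1 + g * p"] by fastforce
    then have "c * ln (1 + g * p) < c * (g * p)"
      using False by (intro mult_strict_left_mono) auto
    also have "\<dots> = (g * c) * p" by simp
    also have "\<dots> \<le> \<gamma> * p" using gc \<open>0 < p\<close> by (intro mult_right_mono) auto
    finally show ?thesis .
  qed
  then show ?thesis by (simp add: w net_rate_def)
next
  case False
  define w where "w = water_level c \<gamma> g"
  have w: "w = c / \<gamma> - 1 / g" "0 < w" using False by (auto simp: w_def water_level_def)
  have c: "0 < c"
  proof -
    have "0 < 1 / g" using assms by simp
    then have "0 < c / \<gamma>" using False by linarith
    then show ?thesis using assms by (simp add: zero_less_divide_iff)
  qed
  \<comment> \<open>The first-order condition \<open>c g / (1 + g w) = \<gamma>\<close>, solved for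
    \<open>1 + g w\<close>. It turns \<open>c * (t - 1)\<close> into exactly the difference of the
    power costs.\<close>
  have gw: "1 + g * w = g * c / \<gamma>" using assms w by (simp add: field_simps)
  define t where "t = (1 + g * p) / (1 + g * w)"
  have pos: "0 < 1 + g * p" "0 < 1 + g * w"
    using assms w by (auto intro!: add_pos_nonneg)
  have t1: "t - 1 = \<gamma> * (p - w) / c"
    using assms c pos unfolding t_def gw by (simp add: field_simps w)
  have "t \<noteq> 1" "0 < t"
    using t1 assms c pos by (auto simp: w_def t_def)
  then have "ln t < t - 1"
    using ln_le_minus_one[of t] ln_eq_minus_one[of t] by fastforce
  then have "c * ln t < c * (t - 1)"
    using c by simp
  also have "\<dots> = \<gamma> * (p - w)" using c t1 by simp
  finally have "c * (ln (1 + g * p) - ln (1 + g * w)) < \<gamma> * (p - w)"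
    using pos by (simp add: t_def ln_div)
  then show ?thesis by (simp add: net_rate_def w_def algebra_simps)
qed

lemma net_rate_le_water_level:
  assumes "0 < \<gamma>" "0 < g" "0 \<le> p"
  shows "net_rate c \<gamma> g p \<le> net_rate c \<gamma> g (water_level c \<gamma> g)"
  using net_rate_less_water_level[OF assms] by (cases "p = water_level c \<gamma> g") (auto intro: less_imp_le)

lemma net_rate_water_level_nonneg:
  assumes "0 < \<gamma>" "0 < g"
  shows "0 \<le> net_rate c \<gamma> g (water_level c \<gamma> g)"
  using net_rate_le_water_level[OF assms, of 0 c] by (simp add: net_rate_def)

text \<open>Keep the power that is optimal at \<open>g\<close>: its rate grows with the gain, and
  re-optimising at \<open>g'\<close> can only add. A positive optimum forces positive power and
  \<open>c > 0\<close>, which makes the growth strict.\<close>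

lemma net_rate_water_level_strict_mono:
  assumes "0 < \<gamma>" "0 < g" "g < g'" "0 < net_rate c \<gamma> g (water_level c \<gamma> g)"
  shows "net_rate c \<gamma> g (water_level c \<gamma> g) < net_rate c \<gamma> g' (water_level c \<gamma> g')"
proof -
  let ?w = "water_level c \<gamma> g"
  have w: "0 < ?w"
    using assms(4) water_level_nonneg[of c \<gamma> g] by (cases "?w = 0") (auto simp: net_rate_def)
  have c: "0 < c"
  proof -
    have "0 < c / \<gamma> - 1 / g" using w by (auto simp: water_level_def max_def split: if_splits)
    moreover have "0 < 1 / g" using assms by simp
    ultimately have "0 < c / \<gamma>" by linarith
    then show ?thesis using assms by (simp add: zero_less_divide_iff)
  qed
  have "0 < 1 + g * ?w" using w assms by (simp add: add_pos_pos)
  moreover have "g * ?w < g' * ?w" using w assms by simp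
  ultimately have "ln (1 + g * ?w) < ln (1 + g' * ?w)" by simp
  then have "net_rate c \<gamma> g ?w < net_rate c \<gamma> g' ?w"
    using c by (simp add: net_rate_def)
  also have "\<dots> \<le> net_rate c \<gamma> g' (water_level c \<gamma> g')"
    using assms w by (intro net_rate_le_water_level) auto
  finally show ?thesis .
qed

text \<open>The value 0 may be taken on a whole range of gains, hence the positivity assumption. The
  equality carries it to both gains, and strict monotonicity excludes either order.\<close>

lemma net_rate_water_level_inj:
  assumes "0 < \<gamma>" "0 < g" "0 < g'"
    and "0 < net_rate c \<gamma> g (water_level c \<gamma> g)"
    and "net_rate c \<gamma> g (water_level c \<gamma> g) = net_rate c \<gamma> g' (water_level c \<gamma> g')"
  shows "g = g'"
  using net_rate_water_level_strict_mono[of \<gamma> g g' c] net_rate_water_level_strict_mono[of \<gamma> g' g c]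
    assms by (cases g g' rule: linorder_cases) auto

section \<open>The complex normal law: second moment and null circles\<close>

abbreviation half_normal :: "real measure" where
  "half_normal \<equiv> density lborel (\<lambda>x. ennreal (normal_density 0 (sqrt (1/2)) x))"

lemma prob_space_half_normal: "prob_space half_normal"
  by (rule prob_space_normal_density) simp

lemma integrable_half_normal_square: "integrable half_normal (\<lambda>x. x\<^sup>2)"
  using integrable_normal_moment[of "sqrt (1/2)" 0 2]
  by (subst integrable_density) auto

lemma measurable_Complex_pair [measurable]:
  "(\<lambda>(x, y). Complex x y) \<in> half_normal \<Otimes>\<^sub>M half_normal \<rightarrow>\<^sub>M borel"
proof -
  have "(\<lambda>z. complex_of_real (fst z) + \<i> * complex_of_real (snd z))
      \<in> borel_measurable (half_normal \<Otimes>\<^sub>M half_normal)"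
    by measurable
  then show ?thesis by (simp add: Complex_eq case_prod_beta)
qed

lemma sets_complex_normal [simp, measurable_cong]: "sets complex_normal = sets borel"
  by (simp add: complex_normal_def)

lemma space_complex_normal [simp]: "space complex_normal = UNIV"
  by (simp add: complex_normal_def)

lemma prob_space_complex_normal: "prob_space complex_normal"
proof -
  interpret N: prob_space half_normal by (rule prob_space_half_normal)
  interpret N2: pair_prob_space half_normal half_normal by unfold_locales
  show ?thesis unfolding complex_normal_def by (rule N2.P.prob_space_distr) simp
qed

text \<open>\<open>|z|^2\<close> is the sum of the squared coordinates, whose second moments are
  finite. The finite mean gain later dominates the logarithmic rates.\<close>

lemma integrable_complex_normal_cmod_square: "integrable complex_normal (\<lambda>z. (cmod z)\<^sup>2)"
proof -
  interpret N: prob_space half_normal by (rule prob_space_half_normal)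
  interpret N2: pair_prob_space half_normal half_normal by unfold_locales
  have "integrable (distr (half_normal \<Otimes>\<^sub>M half_normal) half_normal fst) (\<lambda>x. x\<^sup>2)"
    using integrable_half_normal_square by (simp only: N.distr_pair_fst)
  then have fst: "integrable (half_normal \<Otimes>\<^sub>M half_normal) (\<lambda>z. (fst z)\<^sup>2)"
    by (subst (asm) integrable_distr_eq) auto
  have "integrable (half_normal \<Otimes>\<^sub>M half_normal) (\<lambda>z. (snd z)\<^sup>2)"
    using N2.integrable_product_swap[OF fst] by (simp add: case_prod_unfold)
  with fst have "integrable (half_normal \<Otimes>\<^sub>M half_normal) (\<lambda>z. (fst z)\<^sup>2 + (snd z)\<^sup>2)"
    by (rule Bochner_Integration.integrable_add)
  then show ?thesis
    unfolding complex_normal_def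
    by (subst integrable_distr_eq) (auto simp: case_prod_beta cmod_power2)
qed

lemma AE_half_normal_neq: "AE x in half_normal. x \<noteq> a"
  by (subst AE_density) (auto intro: AE_mp[OF AE_lborel_singleton])

text \<open>By Fubini: given the real part \<open>x\<close>, only the imaginary parts
  \<open>sqrt (r - x^2)\<close> and \<open>- sqrt (r - x^2)\<close> can lie on the circle, and the
  normal law has no atoms.\<close>

lemma AE_complex_normal_cmod_neq: "AE z in complex_normal. (cmod z)\<^sup>2 \<noteq> r"
proof -
  interpret N: prob_space half_normal by (rule prob_space_half_normal)
  interpret N2: pair_prob_space half_normal half_normal by unfold_locales
  have sec: "AE y in half_normal. x\<^sup>2 + y\<^sup>2 \<noteq> r" for x
    using AE_half_normal_neq[of "sqrt (r - x\<^sup>2)"] AE_half_normal_neq[of "- sqrt (r - x\<^sup>2)"]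
  proof eventually_elim
    case (elim y)
    show ?case
    proof
      assume "x\<^sup>2 + y\<^sup>2 = r"
      then have "sqrt (r - x\<^sup>2) = \<bar>y\<bar>" using real_sqrt_abs[of y] by (simp flip: \<open>x\<^sup>2 + y\<^sup>2 = r\<close>)
      with elim show False by auto
    qed
  qed
  have "AE z in half_normal \<Otimes>\<^sub>M half_normal. (fst z)\<^sup>2 + (snd z)\<^sup>2 \<noteq> r"
    by (rule N2.AE_pair_measure, measurable) (simp add: sec)
  then show ?thesis
    unfolding complex_normal_def
    by (subst AE_distr_iff) (auto simp: case_prod_beta cmod_power2)
qed

text \<open>Disjoint singleton index sets give independent restricted families; evaluating each at
  its only index recovers the two variables.\<close>

lemma (in prob_space) indep_vars_pair:
  assumes "indep_vars M' X I" "i \<in> I" "j \<in> I" "i \<noteq> j"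
  shows "indep_var (M' i) (X i) (M' j) (X j)"
proof -
  have "indep_var (PiM {i} M') (\<lambda>\<omega>. restrict (\<lambda>k. X k \<omega>) {i})
      (PiM {j} M') (\<lambda>\<omega>. restrict (\<lambda>k. X k \<omega>) {j})"
    using assms by (intro indep_var_restrict[OF assms(1)]) auto
  from indep_var_compose[OF this, of "\<lambda>f. f i" "M' i" "\<lambda>f. f j" "M' j"]
  show ?thesis by (simp add: comp_def)
qed

lemma finite_qstates: "finite (qstates S)"
proof -
  have "qstates S = (\<Pi>\<^sub>E k\<in>UNIV. {..queue_cap S})"
    by (auto simp: qstates_def PiE_def)
  then show ?thesis by (simp add: finite_PiE)
qed

section \<open>Minimisation over actions at a fixed channel state\<close>

text \<open>The value of one unit of rate for user \<open>k\<close>, used as the \<open>c\<close> of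
  \<open>net_rate\<close>. It may have either sign, since \<open>V\<close> is arbitrary.\<close>

definition rate_price ::
  "('k :: finite, 'n :: finite) ofdma \<Rightarrow> ('k qsi \<Rightarrow> real) \<Rightarrow> 'k qsi \<Rightarrow> 'k \<Rightarrow> real" where
  "rate_price S V Q k = slot_len S / pkt_mean S k * \<Delta>V V Q k"

lemma water_fill_eq:
  "water_fill S V Q H k n =
     water_level (rate_price S V Q k) (multiplier S) ((cmod (H $ k $ n))\<^sup>2)"
  by (simp add: water_fill_def water_level_def rate_price_def)

lemma X_metric_eq:
  "X_metric S V Q H k n =
     net_rate (rate_price S V Q k) (multiplier S) ((cmod (H $ k $ n))\<^sup>2) (water_fill S V Q H k n)"
  by (simp add: X_metric_def net_rate_def rate_price_def)

lemma X_metric_le_X_max: "X_metric S V Q H k n \<le> X_max S V Q H n"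
  by (simp add: X_max_def)

lemma X_max_attained: "\<exists>k. X_metric S V Q H k n = X_max S V Q H n"
proof -
  have "X_max S V Q H n \<in> range (\<lambda>j. X_metric S V Q H j n)"
    unfolding X_max_def by (intro Max_in) auto
  then show ?thesis by auto
qed

text \<open>The action-dependent share of the objective on one subcarrier. Power is charged for
  every user, so power given to an unserved user is pure loss.\<close>

definition subcarrier_cost ::
  "('k :: finite, 'n :: finite) ofdma \<Rightarrow> ('k qsi \<Rightarrow> real) \<Rightarrow> 'k qsi \<Rightarrow> ('k, 'n) csi
     \<Rightarrow> ('k, 'n) action \<Rightarrow> 'n \<Rightarrow> real" where
  "subcarrier_cost S V Q H a n =
     (\<Sum>k\<in>UNIV. multiplier S * tx_power a k n
        - rate_price S V Q k * (sc_alloc a k n * ln (1 + tx_power a k n * (cmod (H $ k $ n))\<^sup>2)))"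

text \<open>The equality case of the bound by \<open>- X_max\<close>. The last clause admits idling
  only where serving gains nothing, so that one criterion covers \<open>actions\<close> and
  \<open>idle_actions\<close>.\<close>

definition subcarrier_optimal ::
  "('k :: finite, 'n :: finite) ofdma \<Rightarrow> ('k qsi \<Rightarrow> real) \<Rightarrow> 'k qsi \<Rightarrow> ('k, 'n) csi
     \<Rightarrow> ('k, 'n) action \<Rightarrow> 'n \<Rightarrow> bool" where
  "subcarrier_optimal S V Q H a n \<longleftrightarrow>
     (\<forall>k. tx_power a k n = sc_alloc a k n * water_fill S V Q H k n \<and>
          (sc_alloc a k n = 1 \<longrightarrow> X_metric S V Q H k n = X_max S V Q H n)) \<and>
     ((\<Sum>k\<in>UNIV. sc_alloc a k n) = 1 \<or> X_max S V Q H n = 0)"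

lemma actions_subset_idle_actions: "actions \<subseteq> idle_actions"
  by (auto simp: actions_def idle_actions_def)

lemma rules_mono: "A \<subseteq> B \<Longrightarrow> rules S A \<subseteq> rules S B"
  unfolding rules_def by (auto elim!: eventually_mono)

text \<open>Zero power is worth 0. A zero entry is excluded because \<open>1 / 0 = 0\<close>:
  \<open>water_fill\<close> could then be positive at zero gain and cost power without any
  rate.\<close>

lemma X_metric_nonneg:
  assumes "H $ k $ n \<noteq> 0" and "0 < multiplier S"
  shows "0 \<le> X_metric S V Q H k n"
  unfolding X_metric_eq water_fill_eq by (intro net_rate_water_level_nonneg) (use assms in auto)

text \<open>The excess of the cost over \<open>- X_max\<close> is a sum of nonnegative terms; it
  vanishes iff each term does, which is \<open>subcarrier_optimal\<close>.\<close>

lemma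
  fixes S :: "('k :: finite, 'n :: finite) ofdma"
  assumes a: "a \<in> idle_actions" and H: "\<And>k. H $ k $ n \<noteq> 0" and mult: "0 < multiplier S"
  shows subcarrier_cost_ge: "- X_max S V Q H n \<le> subcarrier_cost S V Q H a n"
    and subcarrier_cost_eq_iff:
      "subcarrier_cost S V Q H a n = - X_max S V Q H n \<longleftrightarrow> subcarrier_optimal S V Q H a n"
proof -
  have gain: "0 < (cmod (H $ k $ n))\<^sup>2" for k using H by simp
  let ?s = "\<lambda>k. sc_alloc a k n" and ?p = "\<lambda>k. tx_power a k n"
  let ?X = "\<lambda>k. X_metric S V Q H k n" and ?M = "X_max S V Q H n"
  have s01: "?s k = 0 \<or> ?s k = 1" and p0: "0 \<le> ?p k" and s_sum: "(\<Sum>k\<in>UNIV. ?s k) \<le> 1" for k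
    using a by (auto simp: idle_actions_def)
  have M0: "0 \<le> ?M" using X_metric_nonneg[OF H mult] X_metric_le_X_max by (rule order_trans)
  \<comment> \<open>For an unserved user this is the cost of wasted power; for a served user it is
    the shortfall of the net rate from its optimum \<open>X\<close>.\<close>
  define loss where "loss k = multiplier S * ?p k
      - rate_price S V Q k * (?s k * ln (1 + ?p k * (cmod (H $ k $ n))\<^sup>2)) + ?s k * ?X k" for k
  have loss_iff: "0 \<le> loss k \<and> (loss k = 0 \<longleftrightarrow> ?p k = ?s k * water_fill S V Q H k n)" for k
  proof (cases "?s k = 0")
    case True
    then show ?thesis using p0[of k] mult by (auto simp: loss_def)
  next
    case False
    then have 1: "?s k = 1" using s01[of k] by simp
    have "loss k = ?X k
        - net_rate (rate_price S V Q k) (multiplier S) ((cmod (H $ k $ n))\<^sup>2) (?p k)"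
      by (simp add: loss_def 1 net_rate_def mult.commute)
    then show ?thesis
      using net_rate_less_water_level[OF mult gain[of k] p0[of k], of "rate_price S V Q k"]
      by (cases "?p k = water_fill S V Q H k n") (auto simp: 1 X_metric_eq water_fill_eq)
  qed
  have slack: "0 \<le> ?s k * (?M - ?X k)" for k
    using s01[of k] X_metric_le_X_max[of S V Q H k n] by auto
  have slack_iff: "?s k * (?M - ?X k) = 0 \<longleftrightarrow> (?s k = 1 \<longrightarrow> ?X k = ?M)" for k
    using s01[of k] by auto
  \<comment> \<open>The three nonnegative terms are the losses from misallocated power, from idling, and from
    serving users that are not best.\<close>
  have gap: "subcarrier_cost S V Q H a n + ?M =
      (\<Sum>k\<in>UNIV. loss k) + (1 - (\<Sum>k\<in>UNIV. ?s k)) * ?M + (\<Sum>k\<in>UNIV. ?s k * (?M - ?X k))"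
    by (simp add: subcarrier_cost_def loss_def sum.distrib sum_subtractf algebra_simps
        flip: sum_distrib_left sum_distrib_right)
  have nonneg: "0 \<le> (\<Sum>k\<in>UNIV. loss k)" "0 \<le> (1 - (\<Sum>k\<in>UNIV. ?s k)) * ?M"
      "0 \<le> (\<Sum>k\<in>UNIV. ?s k * (?M - ?X k))"
    using loss_iff slack s_sum M0 by (simp_all add: sum_nonneg)
  then show "- ?M \<le> subcarrier_cost S V Q H a n"
    using gap by linarith
  have "subcarrier_cost S V Q H a n = - ?M \<longleftrightarrow> (\<Sum>k\<in>UNIV. loss k) = 0 \<and>
      (1 - (\<Sum>k\<in>UNIV. ?s k)) * ?M = 0 \<and> (\<Sum>k\<in>UNIV. ?s k * (?M - ?X k)) = 0"
    using gap nonneg by linarith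
  also have "(\<Sum>k\<in>UNIV. loss k) = 0 \<longleftrightarrow> (\<forall>k. ?p k = ?s k * water_fill S V Q H k n)"
    using loss_iff by (subst sum_nonneg_eq_0_iff) auto
  also have "(\<Sum>k\<in>UNIV. ?s k * (?M - ?X k)) = 0 \<longleftrightarrow> (\<forall>k. ?s k = 1 \<longrightarrow> ?X k = ?M)"
    by (subst sum_nonneg_eq_0_iff) (simp_all only: slack_iff slack finite ball_UNIV)
  finally show "subcarrier_cost S V Q H a n = - ?M \<longleftrightarrow> subcarrier_optimal S V Q H a n"
    unfolding subcarrier_optimal_def by auto
qed

section \<open>The candidate minimum and a rule that attains it\<close>

text \<open>Staying value, queue reward and drift due to arrivals; at a full queue
  \<open>q_up\<close> stays at \<open>Q\<close> and the drift vanishes.\<close>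

definition action_free_cost ::
  "('k :: finite, 'n :: finite) ofdma \<Rightarrow> ('k qsi \<Rightarrow> real) \<Rightarrow> 'k qsi \<Rightarrow> real" where
  "action_free_cost S V Q = V Q + (\<Sum>k\<in>UNIV. delay_weight S k * real (Q k) / arr_rate S k
     + arr_rate S k * slot_len S * (V (q_up S Q k) - V Q))"

text \<open>The lower bound from taking the best metric on every subcarrier in every channel state;
  it turns out to be the value of \<open>bellman_T\<close>.\<close>

definition min_cost ::
  "('k :: finite, 'n :: finite) ofdma \<Rightarrow> ('k qsi \<Rightarrow> real) \<Rightarrow> 'k qsi \<Rightarrow> real" where
  "min_cost S V Q =
     action_free_cost S V Q - (\<integral>H. (\<Sum>n\<in>UNIV. X_max S V Q H n) \<partial>csi_law S)"

text \<open>Ties are broken by the enumeration \<^const>\<open>to_nat\<close>, which keeps the choice measurable.\<close>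

definition greedy_policy :: "('k :: finite, 'n :: finite) ofdma \<Rightarrow> ('k qsi \<Rightarrow> real) \<Rightarrow> ('k, 'n) policy"
  where
  "greedy_policy S V Q H = (let
      s = (\<lambda>k n. of_bool (X_metric S V Q H k n = X_max S V Q H n \<and>
            (\<forall>j. X_metric S V Q H j n = X_max S V Q H n \<longrightarrow> to_nat k \<le> to_nat j)))
     in \<lparr> tx_power = (\<lambda>k n. s k n * water_fill S V Q H k n), sc_alloc = s \<rparr>)"

text \<open>Some user is best, and injectivity of \<open>to_nat\<close> leaves exactly one of least
  index.\<close>

lemma greedy_policy_sum: "(\<Sum>k\<in>UNIV. sc_alloc (greedy_policy S V Q H) k n) = 1"
proof -
  let ?best = "\<lambda>k. X_metric S V Q H k n = X_max S V Q H n"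
  obtain k where k: "?best k" "\<And>j. ?best j \<Longrightarrow> to_nat k \<le> to_nat j"
    using X_max_attained[of S V Q H n] ex_has_least_nat[of ?best _ to_nat] by blast
  have "?best j \<and> (\<forall>i. ?best i \<longrightarrow> to_nat j \<le> to_nat i) \<longleftrightarrow> j = k" for j
    using k by (metis order.antisym inj_eq inj_to_nat)
  then show ?thesis by (simp add: greedy_policy_def Let_def of_bool_def)
qed

lemma greedy_policy_optimal: "subcarrier_optimal S V Q H (greedy_policy S V Q H) n"
  using greedy_policy_sum[of S V Q H n]
  by (auto simp: subcarrier_optimal_def greedy_policy_def Let_def)

lemma greedy_policy_in_actions: "greedy_policy S V Q H \<in> actions"
  using greedy_policy_sum[of S V Q H]
  by (auto simp: actions_def greedy_policy_def Let_def water_fill_def)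

lemma subcarrier_optimal_actions_iff:
  assumes "a \<in> actions"
  shows "subcarrier_optimal S V Q H a n \<longleftrightarrow>
    (\<forall>k. tx_power a k n = sc_alloc a k n * water_fill S V Q H k n \<and>
      (sc_alloc a k n = 1 \<longrightarrow> X_metric S V Q H k n = X_max S V Q H n))"
  using assms by (auto simp: subcarrier_optimal_def actions_def)

section \<open>The closed allocation formula at a fixed channel state\<close>

text \<open>A second user selected by the formula would share the positive maximum with
  \<open>k\<close>, against \<open>distinct\<close>.\<close>

lemma alloc_formula_unique:
  fixes S :: "('k :: finite, 'n :: finite) ofdma"
  assumes "X_metric S V Q H k n = X_max S V Q H n" "0 < X_max S V Q H n"
    and distinct: "\<And>j k. j \<noteq> k \<Longrightarrow> 0 < X_metric S V Q H j n \<Longrightarrow>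
      X_metric S V Q H j n \<noteq> X_metric S V Q H k n"
  shows "alloc_formula S V Q H j n = of_bool (j = k)"
  using assms by (auto simp: alloc_formula_def) metis

text \<open>If the maximum is positive, \<open>distinct\<close> makes the maximiser unique, and both
  the formula and every optimal full allocation serve just this user. Otherwise
  \<open>nonneg\<close> makes all metrics 0: the formula idles, and any allocation is as
  good.\<close>

lemma
  fixes S :: "('k :: finite, 'n :: finite) ofdma"
  assumes nonneg: "\<And>k. 0 \<le> X_metric S V Q H k n"
    and distinct: "\<And>j k. j \<noteq> k \<Longrightarrow> 0 < X_metric S V Q H j n \<Longrightarrow>
      X_metric S V Q H j n \<noteq> X_metric S V Q H k n"
  shows formula_policy_sum: "(\<Sum>k\<in>UNIV. alloc_formula S V Q H k n) = of_bool (0 < X_max S V Q H n)"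
    and formula_policy_optimal: "subcarrier_optimal S V Q H (formula_policy S V Q H) n"
    and alloc_formula_iff: "a \<in> actions \<Longrightarrow>
      (\<forall>k. sc_alloc a k n = 1 \<longrightarrow> X_metric S V Q H k n = X_max S V Q H n) \<longleftrightarrow>
      (\<forall>k. 0 < X_max S V Q H n \<longrightarrow> sc_alloc a k n = alloc_formula S V Q H k n)"
proof -
  obtain m where m: "X_metric S V Q H m n = X_max S V Q H n" using X_max_attained by blast
  have formula: "0 < X_max S V Q H n \<Longrightarrow> alloc_formula S V Q H j n = of_bool (j = m)" for j
    by (rule alloc_formula_unique[OF m _ distinct])
  have zero: "X_metric S V Q H k n = X_max S V Q H n" if "\<not> 0 < X_max S V Q H n" for k
    using nonneg[of k] X_metric_le_X_max[of S V Q H k n] that by linarith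
  show sum: "(\<Sum>k\<in>UNIV. alloc_formula S V Q H k n) = of_bool (0 < X_max S V Q H n)"
  proof (cases "0 < X_max S V Q H n")
    case True
    then show ?thesis by (simp add: formula of_bool_def)
  next
    case False
    then show ?thesis by (simp add: alloc_formula_def)
  qed
  have "0 \<le> X_max S V Q H n" using nonneg m by metis
  then show "subcarrier_optimal S V Q H (formula_policy S V Q H) n"
    using sum by (auto simp: subcarrier_optimal_def formula_policy_def alloc_formula_def)
  assume a: "a \<in> actions"
  then have s01: "sc_alloc a k n = 0 \<or> sc_alloc a k n = 1"
    and s_sum: "(\<Sum>k\<in>UNIV. sc_alloc a k n) = 1" for k
    by (auto simp: actions_def)
  show "(\<forall>k. sc_alloc a k n = 1 \<longrightarrow> X_metric S V Q H k n = X_max S V Q H n) \<longleftrightarrow>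
      (\<forall>k. 0 < X_max S V Q H n \<longrightarrow> sc_alloc a k n = alloc_formula S V Q H k n)" (is "?L \<longleftrightarrow> ?R")
  proof
    assume L: ?L
    show ?R
    proof (intro allI impI)
      fix k assume pos: "0 < X_max S V Q H n"
      \<comment> \<open>A served \<open>j\<close> would attain the maximum together with
        \<open>m\<close>, a positive tie. So only \<open>m\<close> can be served, and the sum 1
        forces it to be.\<close>
      have zero: "sc_alloc a j n = 0" if "j \<noteq> m" for j
        using s01[of j] L distinct[of j m] m pos that by auto
      have "(\<Sum>k\<in>UNIV. sc_alloc a k n) = sc_alloc a m n"
        using sum.mono_neutral_right[of UNIV "{m}" "\<lambda>k. sc_alloc a k n"] zero by auto
      then show "sc_alloc a k n = alloc_formula S V Q H k n"
        using s_sum zero[of k] formula[OF pos, of k] by (cases "k = m") auto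
    qed
  next
    assume R: ?R
    show ?L
    proof (intro allI impI)
      fix k assume "sc_alloc a k n = 1"
      then show "X_metric S V Q H k n = X_max S V Q H n"
        using R zero[of k] by (cases "0 < X_max S V Q H n") (auto simp: alloc_formula_def split: if_splits)
    qed
  qed
qed

section \<open>Measurability and integrability over the channel law\<close>

context
  fixes S :: "('k :: finite, 'n :: finite) ofdma"
  assumes system: "ofdma_system S"
begin

interpretation prob_space "csi_law S"
  using system by (simp add: ofdma_system_def)

lemma sets_csi_law [measurable_cong]: "sets (csi_law S) = sets borel"
  using system by (simp add: ofdma_system_def)

lemma distr_csi: "distr (csi_law S) borel (\<lambda>H. H $ k $ n) = complex_normal"
  using system by (simp add: ofdma_system_def)

lemma multiplier_pos: "0 < multiplier S"
  using system by (simp add: ofdma_system_def)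

lemma measurable_csi_entry [measurable]:
  "(\<lambda>H. H $ k $ n) \<in> borel_measurable (csi_law S)"
proof -
  have "(\<lambda>H :: ('k, 'n) csi. H $ k $ n) \<in> borel_measurable borel"
    by (intro borel_measurable_continuous_onI continuous_intros)
  then show ?thesis by (simp add: measurable_cong_sets[OF sets_csi_law refl])
qed

lemma integrable_gain: "integrable (csi_law S) (\<lambda>H. (cmod (H $ k $ n))\<^sup>2)"
  using integrable_complex_normal_cmod_square
  by (subst (asm) distr_csi[of k n, symmetric]) (auto simp: integrable_distr_eq)

text \<open>The circle of radius 0 is null for each of the finitely many entries.\<close>

lemma AE_csi_nonzero: "AE H in csi_law S. \<forall>k n. H $ k $ n \<noteq> 0"
proof -
  have "AE H in csi_law S. H $ k $ n \<noteq> 0" for k n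
    using AE_complex_normal_cmod_neq[of 0]
    by (subst (asm) distr_csi[of k n, symmetric]) (auto simp: AE_distr_iff)
  then show ?thesis by (simp add: AE_all_countable)
qed

lemma measurable_water_fill [measurable]:
  "(\<lambda>H. water_fill S V Q H k n) \<in> borel_measurable (csi_law S)"
  unfolding water_fill_def by measurable

lemma measurable_X_metric [measurable]:
  "(\<lambda>H. X_metric S V Q H k n) \<in> borel_measurable (csi_law S)"
  unfolding X_metric_def by measurable

lemma measurable_X_max [measurable]:
  "(\<lambda>H. X_max S V Q H n) \<in> borel_measurable (csi_law S)"
  unfolding X_max_def by (rule borel_measurable_Max) auto

text \<open>Dropping \<open>1 / |H|^2 \<ge> 0\<close> bounds the power uniformly in the channel,
  which makes it integrable.\<close>

lemma water_fill_bounds: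
  "0 \<le> water_fill S V Q H k n" "water_fill S V Q H k n \<le> max (rate_price S V Q k / multiplier S) 0"
  unfolding water_fill_def rate_price_def by (intro max.cobounded2, intro max.mono) auto

text \<open>The bound \<open>ln (1 + p g) \<le> ln (1 + p) + ln (1 + g) \<le> p + g\<close> trades
  the product, whose mean may be infinite, for a sum with finite mean.\<close>

lemma integrable_ln_gain:
  assumes [measurable]: "p \<in> borel_measurable (csi_law S)" "s \<in> borel_measurable (csi_law S)"
    and p: "integrable (csi_law S) p" and "AE H in csi_law S. 0 \<le> p H \<and> s H \<in> {0, 1}"
  shows "integrable (csi_law S) (\<lambda>H. s H * ln (1 + p H * (cmod (H $ k $ n))\<^sup>2))"
proof (rule Bochner_Integration.integrable_bound)
  show "integrable (csi_law S) (\<lambda>H. p H + (cmod (H $ k $ n))\<^sup>2)"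
    using p integrable_gain by (rule Bochner_Integration.integrable_add)
  show "(\<lambda>H. s H * ln (1 + p H * (cmod (H $ k $ n))\<^sup>2)) \<in> borel_measurable (csi_law S)"
    by measurable
  show "AE H in csi_law S. norm (s H * ln (1 + p H * (cmod (H $ k $ n))\<^sup>2))
      \<le> norm (p H + (cmod (H $ k $ n))\<^sup>2)"
    using assms(4)
  proof eventually_elim
    case (elim H)
    let ?g = "(cmod (H $ k $ n))\<^sup>2"
    have pg: "0 \<le> p H * ?g" using elim by simp
    have "1 + p H * ?g \<le> (1 + p H) * (1 + ?g)" using elim by (simp add: algebra_simps)
    then have "ln (1 + p H * ?g) \<le> ln ((1 + p H) * (1 + ?g))"
      using pg elim by (subst ln_le_cancel_iff) (auto intro!: mult_pos_pos add_pos_nonneg)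
    also have "\<dots> = ln (1 + p H) + ln (1 + ?g)"
      using elim add_pos_nonneg[of 1 ?g] by (subst ln_mult) auto
    also have "\<dots> \<le> p H + ?g"
      using elim by (intro add_mono ln_add_one_self_le_self) auto
    finally show ?case using elim pg by auto
  qed
qed

lemma
  assumes u: "u \<in> rules S idle_actions"
  shows integrable_rate: "integrable (csi_law S)
      (\<lambda>H. sc_alloc (u H) k n * ln (1 + tx_power (u H) k n * (cmod (H $ k $ n))\<^sup>2))"
    and integrable_power: "integrable (csi_law S) (\<lambda>H. tx_power (u H) k n)"
    and integrable_subcarrier_cost: "integrable (csi_law S) (\<lambda>H. subcarrier_cost S V Q H (u H) n)"
proof -
  show pow: "integrable (csi_law S) (\<lambda>H. tx_power (u H) k n)" for k
    using u by (simp add: rules_def)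
  have "AE H in csi_law S. u H \<in> idle_actions" using u by (simp add: rules_def)
  then have "AE H in csi_law S. 0 \<le> tx_power (u H) k n \<and> sc_alloc (u H) k n \<in> {0, 1}" for k
    by eventually_elim (auto simp: idle_actions_def)
  then show rate: "integrable (csi_law S)
      (\<lambda>H. sc_alloc (u H) k n * ln (1 + tx_power (u H) k n * (cmod (H $ k $ n))\<^sup>2))" for k
    using u by (intro integrable_ln_gain pow) (auto simp: rules_def)
  show "integrable (csi_law S) (\<lambda>H. subcarrier_cost S V Q H (u H) n)"
    unfolding subcarrier_cost_def
    by (intro Bochner_Integration.integrable_sum Bochner_Integration.integrable_diff
        integrable_mult_right pow rate)
qed

section \<open>The Bellman objective as an expected subcarrier cost\<close>

text \<open>The remaining mass stays at \<open>Q\<close>, so each move contributes its mass times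
  the change of \<open>V\<close>. A departure from queue \<open>k\<close> changes \<open>V\<close>
  by \<open>- \<Delta>V V Q k\<close>, and its mass is an integral of rates; linearity collects the
  terms by subcarrier.\<close>

lemma bellman_objective_eq:
  assumes u: "u \<in> rules S idle_actions" and Q: "Q \<in> qstates S"
  shows "bellman_objective S V Q u = action_free_cost S V Q
    + (\<integral>H. (\<Sum>n\<in>UNIV. subcarrier_cost S V Q H (u H) n) \<partial>csi_law S)"
proof -
  \<comment> \<open>Both targets lie in the finite state space, so the sum meets each point mass. At
    an empty queue \<open>q_down Q k = Q\<close>, and the term has
    \<open>\<Delta>V V Q k = 0\<close>.\<close>
  have mem: "q_up S Q k \<in> qstates S" "q_down Q k \<in> qstates S" for k
    using Q by (auto simp: qstates_def q_up_def q_down_def intro: le_trans[OF diff_le_self])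
  have point: "(\<Sum>Q'\<in>qstates S. c * of_bool (Q' = Q0) * V Q') = c * V Q0"
    if "Q0 \<in> qstates S" for c Q0
  proof -
    have "(\<Sum>Q'\<in>qstates S. c * of_bool (Q' = Q0) * V Q') =
        (\<Sum>Q'\<in>qstates S. if Q' = Q0 then c * V Q0 else 0)"
      by (intro sum.cong) auto
    with that show ?thesis by (simp add: finite_qstates)
  qed
  let ?a = "\<lambda>k. arr_rate S k * slot_len S" and ?m = "\<lambda>k. mean_rate S u k * slot_len S"
  have "(\<Sum>Q'\<in>qstates S. kernel S Q u Q' * V Q') =
      (\<Sum>k\<in>UNIV. \<Sum>Q'\<in>qstates S. ?a k * of_bool (Q' = q_up S Q k) * V Q'
        + ?m k * of_bool (Q' = q_down Q k) * V Q')
      + (\<Sum>Q'\<in>qstates S. (1 - (\<Sum>k\<in>UNIV. ?a k + ?m k)) * of_bool (Q' = Q) * V Q')"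
    unfolding kernel_def distrib_right sum_distrib_right sum.distrib
    by (simp add: sum.swap[of _ UNIV])
  also have "\<dots> = (\<Sum>k\<in>UNIV. ?a k * V (q_up S Q k) + ?m k * V (q_down Q k))
      + (1 - (\<Sum>k\<in>UNIV. ?a k + ?m k)) * V Q"
    by (simp only: sum.distrib point mem Q)
  also have "\<dots> = V Q + (\<Sum>k\<in>UNIV. ?a k * (V (q_up S Q k) - V Q)) - (\<Sum>k\<in>UNIV. ?m k * \<Delta>V V Q k)"
    by (simp add: \<Delta>V_def algebra_simps sum.distrib sum_subtractf sum_distrib_left)
  finally have kernel: "(\<Sum>Q'\<in>qstates S. kernel S Q u Q' * V Q') =
      V Q + (\<Sum>k\<in>UNIV. ?a k * (V (q_up S Q k) - V Q)) - (\<Sum>k\<in>UNIV. ?m k * \<Delta>V V Q k)" .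
  have rate: "?m k * \<Delta>V V Q k = (\<Sum>n\<in>UNIV. rate_price S V Q k *
      (\<integral>H. sc_alloc (u H) k n * ln (1 + tx_power (u H) k n * (cmod (H $ k $ n))\<^sup>2) \<partial>csi_law S))" for k
    unfolding mean_rate_def rate_price_def
    by (subst Bochner_Integration.integral_sum)
      (auto simp: integrable_rate[OF u] sum_distrib_left sum_divide_distrib mult_ac)
  have reward: "mean_reward S Q u = (\<Sum>k\<in>UNIV. delay_weight S k * real (Q k) / arr_rate S k)
      + (\<Sum>k\<in>UNIV. \<Sum>n\<in>UNIV. multiplier S * (\<integral>H. tx_power (u H) k n \<partial>csi_law S))"
    unfolding mean_reward_def
    by (subst Bochner_Integration.integral_add)
      (auto simp: integrable_power[OF u] prob_space sum_distrib_left)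
  have cost: "(\<integral>H. (\<Sum>n\<in>UNIV. subcarrier_cost S V Q H (u H) n) \<partial>csi_law S) =
      (\<Sum>k\<in>UNIV. \<Sum>n\<in>UNIV. multiplier S * (\<integral>H. tx_power (u H) k n \<partial>csi_law S)) -
      (\<Sum>k\<in>UNIV. \<Sum>n\<in>UNIV. rate_price S V Q k *
      (\<integral>H. sc_alloc (u H) k n * ln (1 + tx_power (u H) k n * (cmod (H $ k $ n))\<^sup>2) \<partial>csi_law S))"
    unfolding subcarrier_cost_def
    by (simp add: integrable_power[OF u] integrable_rate[OF u] sum_subtractf)
      (subst (1 2) sum.swap, simp)
  show ?thesis
    unfolding bellman_objective_def kernel rate reward cost action_free_cost_def
    by (simp add: sum.distrib)
qed

section \<open>The minimum of the Bellman objective and its minimisers\<close>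

lemma integrable_water_fill: "integrable (csi_law S) (\<lambda>H. water_fill S V Q H k n)"
proof (rule integrable_const_bound)
  show "AE H in csi_law S. norm (water_fill S V Q H k n) \<le> max (rate_price S V Q k / multiplier S) 0"
    using water_fill_bounds[of V Q _ k n] by auto
qed measurable

lemma integrable_alloc_water_fill:
  assumes "s \<in> borel_measurable (csi_law S)" "\<And>H. s H \<in> {0, 1}"
  shows "integrable (csi_law S) (\<lambda>H. s H * water_fill S V Q H k n)"
proof (rule Bochner_Integration.integrable_bound[OF integrable_water_fill[of V Q k n]])
  show "(\<lambda>H. s H * water_fill S V Q H k n) \<in> borel_measurable (csi_law S)"
    using assms(1) by measurable
  have "norm (s H * water_fill S V Q H k n) \<le> norm (water_fill S V Q H k n)" for H
    using assms(2)[of H] by auto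
  then show "AE H in csi_law S. norm (s H * water_fill S V Q H k n) \<le> norm (water_fill S V Q H k n)"
    by simp
qed

text \<open>The maximum is one of finitely many integrable metrics, so its modulus is at most the
  sum of theirs.\<close>

lemma integrable_X_max: "integrable (csi_law S) (\<lambda>H. X_max S V Q H n)"
proof (rule Bochner_Integration.integrable_bound)
  have "integrable (csi_law S) (\<lambda>H. 1 * ln (1 + water_fill S V Q H k n * (cmod (H $ k $ n))\<^sup>2))" for k
    by (intro integrable_ln_gain integrable_water_fill) (auto simp: water_fill_bounds)
  then have "integrable (csi_law S) (\<lambda>H. X_metric S V Q H k n)" for k
    unfolding X_metric_def
    by (intro Bochner_Integration.integrable_diff integrable_mult_right integrable_water_fill)
      (simp add: mult.commute)
  then show "integrable (csi_law S) (\<lambda>H. \<Sum>k\<in>UNIV. \<bar>X_metric S V Q H k n\<bar>)"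
    by (intro Bochner_Integration.integrable_sum integrable_abs)
  have "norm (X_max S V Q H n) \<le> norm (\<Sum>k\<in>UNIV. \<bar>X_metric S V Q H k n\<bar>)" for H
  proof -
    obtain k where "X_metric S V Q H k n = X_max S V Q H n" using X_max_attained by blast
    moreover have "\<bar>X_metric S V Q H k n\<bar> \<le> (\<Sum>k\<in>UNIV. \<bar>X_metric S V Q H k n\<bar>)"
      by (rule member_le_sum) auto
    ultimately show ?thesis by simp
  qed
  then show "AE H in csi_law S.
      norm (X_max S V Q H n) \<le> norm (\<Sum>k\<in>UNIV. \<bar>X_metric S V Q H k n\<bar>)"
    by simp
qed measurable

text \<open>The objective exceeds \<open>min_cost\<close> by the integral of the pointwise gaps.
  These are almost surely nonnegative, so the integral is 0 only if they vanish almost surely.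
  Working in \<open>idle_actions\<close> covers the closed formula too.\<close>

lemma
  assumes u: "u \<in> rules S idle_actions" and Q: "Q \<in> qstates S"
  shows min_cost_le: "min_cost S V Q \<le> bellman_objective S V Q u"
    and bellman_objective_eq_min_cost_iff: "bellman_objective S V Q u = min_cost S V Q \<longleftrightarrow>
      (AE H in csi_law S. \<forall>n. subcarrier_optimal S V Q H (u H) n)"
proof -
  let ?gap = "\<lambda>H n. subcarrier_cost S V Q H (u H) n + X_max S V Q H n"
  have int: "integrable (csi_law S) (\<lambda>H. ?gap H n)" for n
    by (intro Bochner_Integration.integrable_add integrable_subcarrier_cost[OF u] integrable_X_max)
  have diff: "bellman_objective S V Q u - min_cost S V Q = (\<integral>H. (\<Sum>n\<in>UNIV. ?gap H n) \<partial>csi_law S)"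
    unfolding bellman_objective_eq[OF u Q] min_cost_def
    by (simp add: integrable_subcarrier_cost[OF u] integrable_X_max sum.distrib)
  have "AE H in csi_law S. u H \<in> idle_actions" using u by (simp add: rules_def)
  with AE_csi_nonzero
  have gap: "AE H in csi_law S. \<forall>n. 0 \<le> ?gap H n \<and> (?gap H n = 0 \<longleftrightarrow> subcarrier_optimal S V Q H (u H) n)"
  proof eventually_elim
    case (elim H)
    show ?case
    proof
      fix n
      have H: "\<And>k. H $ k $ n \<noteq> 0" using elim by simp
      show "0 \<le> ?gap H n \<and> (?gap H n = 0 \<longleftrightarrow> subcarrier_optimal S V Q H (u H) n)"
        using subcarrier_cost_ge[OF elim(2) H multiplier_pos, of V Q]
          subcarrier_cost_eq_iff[OF elim(2) H multiplier_pos, of V Q]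
        by (simp add: add_eq_0_iff2)
    qed
  qed
  then have nonneg: "AE H in csi_law S. 0 \<le> (\<Sum>n\<in>UNIV. ?gap H n)"
    by eventually_elim (auto intro: sum_nonneg)
  show "min_cost S V Q \<le> bellman_objective S V Q u"
    using integral_nonneg_AE[OF nonneg] diff by simp
  have "bellman_objective S V Q u = min_cost S V Q \<longleftrightarrow> (\<integral>H. (\<Sum>n\<in>UNIV. ?gap H n) \<partial>csi_law S) = 0"
    using diff by linarith
  also have "\<dots> \<longleftrightarrow> (AE H in csi_law S. (\<Sum>n\<in>UNIV. ?gap H n) = 0)"
    by (rule integral_nonneg_eq_0_iff_AE[OF _ nonneg]) (intro Bochner_Integration.integrable_sum int)
  also have "\<dots> \<longleftrightarrow> (AE H in csi_law S. \<forall>n. subcarrier_optimal S V Q H (u H) n)"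
  proof (rule eventually_subst)
    show "AE H in csi_law S. ((\<Sum>n\<in>UNIV. ?gap H n) = 0) = (\<forall>n. subcarrier_optimal S V Q H (u H) n)"
      using gap
    proof eventually_elim
      case (elim H)
      then have "(\<Sum>n\<in>UNIV. ?gap H n) = 0 \<longleftrightarrow> (\<forall>n\<in>UNIV. ?gap H n = 0)"
        by (intro sum_nonneg_eq_0_iff) auto
      with elim show ?case by blast
    qed
  qed
  finally show "bellman_objective S V Q u = min_cost S V Q \<longleftrightarrow>
      (AE H in csi_law S. \<forall>n. subcarrier_optimal S V Q H (u H) n)" .
qed

lemma greedy_policy_in_rules: "greedy_policy S V Q \<in> rules S actions"
proof -
  have alloc: "(\<lambda>H. sc_alloc (greedy_policy S V Q H) k n) \<in> borel_measurable (csi_law S)" for k n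
    unfolding greedy_policy_def Let_def action.simps of_bool_def by measurable
  have power: "tx_power (greedy_policy S V Q H) k n =
      sc_alloc (greedy_policy S V Q H) k n * water_fill S V Q H k n" for H k n
    by (simp add: greedy_policy_def Let_def)
  have int: "integrable (csi_law S) (\<lambda>H. tx_power (greedy_policy S V Q H) k n)" for k n
    unfolding power
  proof (rule integrable_alloc_water_fill[OF alloc])
    show "sc_alloc (greedy_policy S V Q H) k n \<in> {0, 1}" for H
      using greedy_policy_in_actions[of S V Q H] by (auto simp: actions_def)
  qed
  show ?thesis
    unfolding rules_def using alloc int borel_measurable_integrable[OF int] greedy_policy_in_actions by blast
qed

text \<open>The lower bound is attained with every subcarrier in use, so the infimum in
  \<open>bellman_T\<close> is a minimum.\<close>

lemma greedy_policy_attains_min_cost: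
  assumes "Q \<in> qstates S"
  shows "bellman_objective S V Q (greedy_policy S V Q) = min_cost S V Q"
proof -
  have "greedy_policy S V Q \<in> rules S idle_actions"
    using greedy_policy_in_rules rules_mono[OF actions_subset_idle_actions] by blast
  then show ?thesis
    by (simp add: bellman_objective_eq_min_cost_iff assms greedy_policy_optimal)
qed

lemma bellman_T_eq_min_cost:
  assumes "Q \<in> qstates S"
  shows "bellman_T S V Q = min_cost S V Q"
  unfolding bellman_T_def
proof (rule cInf_eq_minimum)
  show "min_cost S V Q \<in> bellman_objective S V Q ` rules S actions"
    using greedy_policy_attains_min_cost[OF assms] greedy_policy_in_rules by (metis image_eqI)
  show "min_cost S V Q \<le> x" if "x \<in> bellman_objective S V Q ` rules S actions" for x
    using that min_cost_le[OF _ assms] rules_mono[OF actions_subset_idle_actions] by auto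
qed

text \<open>As \<open>greedy_policy\<close> attains \<open>min_cost\<close>, the minimisers are the
  rules of cost \<open>min_cost\<close>, and the equality case of the lower bound describes
  them.\<close>

lemma is_arg_min_actions_iff:
  assumes Q: "Q \<in> qstates S"
  shows "is_arg_min (bellman_objective S V Q) (\<lambda>u. u \<in> rules S actions) u \<longleftrightarrow>
    u \<in> rules S actions \<and> (AE H in csi_law S. \<forall>k n.
      tx_power (u H) k n = sc_alloc (u H) k n * water_fill S V Q H k n \<and>
      (sc_alloc (u H) k n = 1 \<longrightarrow> X_metric S V Q H k n = X_max S V Q H n))"
proof (cases "u \<in> rules S actions")
  case True
  then have idle: "u \<in> rules S idle_actions" using rules_mono[OF actions_subset_idle_actions] by auto
  have "is_arg_min (bellman_objective S V Q) (\<lambda>u. u \<in> rules S actions) u \<longleftrightarrow>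
      bellman_objective S V Q u = min_cost S V Q"
  proof
    assume "is_arg_min (bellman_objective S V Q) (\<lambda>u. u \<in> rules S actions) u"
    \<comment> \<open>\<open>is_arg_min\<close> only excludes strictly better rules; comparison with
      \<open>greedy_policy\<close> bounds the cost above by \<open>min_cost\<close>.\<close>
    then have "\<not> bellman_objective S V Q (greedy_policy S V Q) < bellman_objective S V Q u"
      using greedy_policy_in_rules unfolding is_arg_min_def by blast
    then show "bellman_objective S V Q u = min_cost S V Q"
      using min_cost_le[OF idle Q, of V] greedy_policy_attains_min_cost[OF Q, of V] by linarith
  next
    assume "bellman_objective S V Q u = min_cost S V Q"
    moreover have "min_cost S V Q \<le> bellman_objective S V Q v" if "v \<in> rules S actions" for v
      using that min_cost_le[OF _ Q] rules_mono[OF actions_subset_idle_actions] by blast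
    ultimately show "is_arg_min (bellman_objective S V Q) (\<lambda>u. u \<in> rules S actions) u"
      using True by (auto simp: is_arg_min_def not_less)
  qed
  also have "\<dots> \<longleftrightarrow> (AE H in csi_law S. \<forall>n. subcarrier_optimal S V Q H (u H) n)"
    by (rule bellman_objective_eq_min_cost_iff[OF idle Q])
  also have "\<dots> \<longleftrightarrow> (AE H in csi_law S. \<forall>k n.
      tx_power (u H) k n = sc_alloc (u H) k n * water_fill S V Q H k n \<and>
      (sc_alloc (u H) k n = 1 \<longrightarrow> X_metric S V Q H k n = X_max S V Q H n))"
  proof -
    have "AE H in csi_law S. u H \<in> actions" using True by (simp add: rules_def)
    then have "AE H in csi_law S. (\<forall>n. subcarrier_optimal S V Q H (u H) n) = (\<forall>k n.
      tx_power (u H) k n = sc_alloc (u H) k n * water_fill S V Q H k n \<and>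
      (sc_alloc (u H) k n = 1 \<longrightarrow> X_metric S V Q H k n = X_max S V Q H n))"
      by eventually_elim (auto simp: subcarrier_optimal_actions_iff)
    then show ?thesis by (rule eventually_subst)
  qed
  finally show ?thesis using True by simp
qed (simp add: is_arg_min_def)

section \<open>Positive ties have probability zero\<close>

lemma AE_X_metric_distinct:
  assumes indep: "csi_indep_users S"
  shows "AE H in csi_law S. \<forall>n j k. j \<noteq> k \<longrightarrow> 0 < X_metric S V Q H j n \<longrightarrow>
    X_metric S V Q H j n \<noteq> X_metric S V Q H k n"
proof -
  have "AE H in csi_law S. 0 < X_metric S V Q H j n \<longrightarrow> X_metric S V Q H j n \<noteq> X_metric S V Q H k n"
    if "j \<noteq> k" for n and j k :: 'k
  proof -
    interpret C: prob_space complex_normal by (rule prob_space_complex_normal)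
    interpret C2: pair_prob_space complex_normal complex_normal by unfold_locales
    define f where "f k h = (let g = (cmod h)\<^sup>2 in
      net_rate (rate_price S V Q k) (multiplier S) g (water_level (rate_price S V Q k) (multiplier S) g))" for k h
    have f: "X_metric S V Q H k n = f k (H $ k $ n)" for H k
      by (simp add: f_def Let_def X_metric_eq water_fill_eq)
    have [measurable]: "f k \<in> borel_measurable borel" for k
      unfolding f_def Let_def net_rate_def water_level_def by measurable
    have "indep_vars (\<lambda>_. borel) (\<lambda>k H. H $ k $ n) UNIV"
      using indep by (simp add: csi_indep_users_def)
    from indep_vars_pair[OF this _ _ that]
    have "indep_var borel (\<lambda>H. H $ j $ n) borel (\<lambda>H. H $ k $ n)" by simp
    then have joint: "complex_normal \<Otimes>\<^sub>M complex_normal =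
        distr (csi_law S) (borel \<Otimes>\<^sub>M borel) (\<lambda>H. (H $ j $ n, H $ k $ n))"
      unfolding indep_var_distribution_eq distr_csi by simp
    \<comment> \<open>If some nonzero \<open>b0\<close> reaches the value of \<open>a\<close>,
      injectivity puts every nonzero \<open>b\<close> that ties on the circle through
      \<open>b0\<close>; if none does, only \<open>b = 0\<close> could tie. Zero stands apart
      because \<open>net_rate_water_level_inj\<close> requires positive gains.\<close>
    have sec: "AE b in complex_normal. 0 < f j a \<longrightarrow> f j a \<noteq> f k b" for a
    proof (cases "\<exists>b0. b0 \<noteq> 0 \<and> f k b0 = f j a")
      case True
      then obtain b0 where b0: "b0 \<noteq> 0" "f k b0 = f j a" by blast
      show ?thesis
        using AE_complex_normal_cmod_neq[of "(cmod b0)\<^sup>2"] AE_complex_normal_cmod_neq[of 0]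
      proof eventually_elim
        case (elim b)
        show ?case
        proof (intro impI notI)
          assume "0 < f j a" "f j a = f k b"
          have "(cmod b0)\<^sup>2 = (cmod b)\<^sup>2"
          proof (rule net_rate_water_level_inj[OF multiplier_pos])
            show "0 < (cmod b0)\<^sup>2" "0 < (cmod b)\<^sup>2" using b0(1) elim(2) by simp_all
            show "0 < net_rate (rate_price S V Q k) (multiplier S) ((cmod b0)\<^sup>2)
                (water_level (rate_price S V Q k) (multiplier S) ((cmod b0)\<^sup>2))"
              using \<open>0 < f j a\<close> unfolding b0(2)[symmetric] by (simp add: f_def Let_def)
            show "net_rate (rate_price S V Q k) (multiplier S) ((cmod b0)\<^sup>2)
                (water_level (rate_price S V Q k) (multiplier S) ((cmod b0)\<^sup>2)) =
              net_rate (rate_price S V Q k) (multiplier S) ((cmod b)\<^sup>2)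
                (water_level (rate_price S V Q k) (multiplier S) ((cmod b)\<^sup>2))"
              using \<open>f j a = f k b\<close> unfolding b0(2)[symmetric] by (simp add: f_def Let_def)
          qed
          with elim(1) show False by simp
        qed
      qed
    next
      case False
      show ?thesis
        using AE_complex_normal_cmod_neq[of 0] by eventually_elim (use False in auto)
    qed
    have "AE z in complex_normal \<Otimes>\<^sub>M complex_normal. 0 < f j (fst z) \<longrightarrow> f j (fst z) \<noteq> f k (snd z)"
      by (rule C2.AE_pair_measure, measurable) (simp only: fst_conv snd_conv sec eventually_True)
    then show ?thesis
      unfolding joint f by (subst (asm) AE_distr_iff) auto
  qed
  then have "AE H in csi_law S. j \<noteq> k \<longrightarrow> 0 < X_metric S V Q H j n \<longrightarrow>
      X_metric S V Q H j n \<noteq> X_metric S V Q H k n" for n and j k :: 'k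
    by (cases "j = k") simp_all
  then show ?thesis by (intro AE_all_countable[THEN iffD2] allI)
qed

section \<open>Optimality of the closed formula\<close>

lemma AE_formula_conditions:
  assumes "csi_indep_users S"
  shows "AE H in csi_law S. \<forall>n. (\<forall>k. 0 \<le> X_metric S V Q H k n) \<and>
    (\<forall>j k. j \<noteq> k \<longrightarrow> 0 < X_metric S V Q H j n \<longrightarrow> X_metric S V Q H j n \<noteq> X_metric S V Q H k n)"
  using AE_X_metric_distinct[OF assms, of V Q] AE_csi_nonzero
proof eventually_elim
  case (elim H)
  then have "0 \<le> X_metric S V Q H k n" for k n
    by (intro X_metric_nonneg multiplier_pos) auto
  with elim show ?case by simp
qed

text \<open>Almost surely, a positive maximum singles out one user, and where the maximum is 0
  neither side restricts the allocation.\<close>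

lemma AE_optimal_iff_alloc_formula:
  assumes indep: "csi_indep_users S" and u: "u \<in> rules S actions"
  shows "(AE H in csi_law S. \<forall>k n.
      tx_power (u H) k n = sc_alloc (u H) k n * water_fill S V Q H k n \<and>
      (sc_alloc (u H) k n = 1 \<longrightarrow> X_metric S V Q H k n = X_max S V Q H n)) \<longleftrightarrow>
    (AE H in csi_law S. \<forall>k n.
      tx_power (u H) k n = sc_alloc (u H) k n * water_fill S V Q H k n \<and>
      (0 < X_max S V Q H n \<longrightarrow> sc_alloc (u H) k n = alloc_formula S V Q H k n))"
proof (rule eventually_subst)
  have "AE H in csi_law S. u H \<in> actions" using u by (simp add: rules_def)
  with AE_formula_conditions[OF indep, of V Q]
  show "AE H in csi_law S. (\<forall>k n.
      tx_power (u H) k n = sc_alloc (u H) k n * water_fill S V Q H k n \<and>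
      (sc_alloc (u H) k n = 1 \<longrightarrow> X_metric S V Q H k n = X_max S V Q H n)) = (\<forall>k n.
      tx_power (u H) k n = sc_alloc (u H) k n * water_fill S V Q H k n \<and>
      (0 < X_max S V Q H n \<longrightarrow> sc_alloc (u H) k n = alloc_formula S V Q H k n))"
  proof eventually_elim
    case (elim H)
    have "(\<forall>k. sc_alloc (u H) k n = 1 \<longrightarrow> X_metric S V Q H k n = X_max S V Q H n) \<longleftrightarrow>
      (\<forall>k. 0 < X_max S V Q H n \<longrightarrow> sc_alloc (u H) k n = alloc_formula S V Q H k n)" for n
      by (rule alloc_formula_iff) (use elim in blast)+
    \<comment> \<open>The equivalence holds for each subcarrier with all users at once, so the
      quantifiers are exchanged to use it.\<close>
    then have "(\<forall>k n. sc_alloc (u H) k n = 1 \<longrightarrow> X_metric S V Q H k n = X_max S V Q H n) \<longleftrightarrow>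
      (\<forall>k n. 0 < X_max S V Q H n \<longrightarrow> sc_alloc (u H) k n = alloc_formula S V Q H k n)"
      by (subst (1 2) all_comm) (simp only:)
    then show ?case by (simp only: all_conj_distrib)
  qed
qed

text \<open>At a positive tie the formula would serve two users; such ties are null, and
  \<open>rules\<close> asks for admissibility only almost surely. It idles where the maximum is 0,
  hence \<open>idle_actions\<close>.\<close>

lemma formula_policy_in_rules:
  assumes indep: "csi_indep_users S"
  shows "formula_policy S V Q \<in> rules S idle_actions"
proof -
  have [measurable]: "(\<lambda>H. alloc_formula S V Q H k n) \<in> borel_measurable (csi_law S)" for k n
    unfolding alloc_formula_def by measurable
  have "integrable (csi_law S) (\<lambda>H. alloc_formula S V Q H k n * water_fill S V Q H k n)" for k n
    by (rule integrable_alloc_water_fill) (auto simp: alloc_formula_def)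
  moreover have "AE H in csi_law S. formula_policy S V Q H \<in> idle_actions"
    using AE_formula_conditions[OF indep, of V Q]
  proof eventually_elim
    case (elim H)
    have "(\<Sum>k\<in>UNIV. alloc_formula S V Q H k n) = of_bool (0 < X_max S V Q H n)" for n
      by (rule formula_policy_sum) (use elim in auto)
    then show ?case
      by (auto simp: idle_actions_def formula_policy_def alloc_formula_def water_fill_def)
  qed
  ultimately show ?thesis by (simp add: rules_def formula_policy_def)
qed

lemma formula_policy_attains_min_cost:
  assumes indep: "csi_indep_users S" and Q: "Q \<in> qstates S"
  shows "bellman_objective S V Q (formula_policy S V Q) = min_cost S V Q"
proof -
  have "AE H in csi_law S. \<forall>n. subcarrier_optimal S V Q H (formula_policy S V Q H) n"
    using AE_formula_conditions[OF indep, of V Q]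
  proof eventually_elim
    case (elim H)
    show ?case by (intro allI formula_policy_optimal) (use elim in auto)
  qed
  then show ?thesis
    by (simp add: bellman_objective_eq_min_cost_iff formula_policy_in_rules indep Q)
qed

end

theorem lemma2:
  fixes S :: "('k :: finite, 'n :: finite) ofdma"
    and V :: "'k qsi \<Rightarrow> real"
    and \<Omega> :: "('k, 'n) policy"
    and \<pi> :: "(('k, 'n) csi \<times> 'k qsi) measure"
    and P0 :: real
  assumes system: "ofdma_system S"
    and steady: "steady_state S \<Omega> \<pi>"
    and power_constraint: "average_power S \<Omega> \<pi> \<le> P0"
  shows "argmin_T S V \<noteq> {} \<and>
    (\<Omega> \<in> argmin_T S V \<longleftrightarrow>
      (\<forall>Q\<in>qstates S. \<Omega> Q \<in> rules S actions \<and>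
        (AE H in csi_law S. \<forall>k n.
          tx_power (\<Omega> Q H) k n = sc_alloc (\<Omega> Q H) k n * water_fill S V Q H k n \<and>
          (sc_alloc (\<Omega> Q H) k n = 1 \<longrightarrow> X_metric S V Q H k n = X_max S V Q H n)))) \<and>
    (csi_indep_users S \<longrightarrow>
      (\<Omega> \<in> argmin_T S V \<longleftrightarrow>
        (\<forall>Q\<in>qstates S. \<Omega> Q \<in> rules S actions \<and>
          (AE H in csi_law S. \<forall>k n.
            tx_power (\<Omega> Q H) k n = sc_alloc (\<Omega> Q H) k n * water_fill S V Q H k n \<and>
            (0 < X_max S V Q H n \<longrightarrow> sc_alloc (\<Omega> Q H) k n = alloc_formula S V Q H k n)))) \<and>
      (\<forall>Q\<in>qstates S.
        is_arg_min (bellman_objective S V Q) (\<lambda>u. u \<in> rules S idle_actions)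
          (formula_policy S V Q) \<and>
        bellman_objective S V Q (formula_policy S V Q) = bellman_T S V Q))"
proof (intro conjI impI ballI)
  \<comment> \<open>The witness attains the lower bound \<open>min_cost\<close> at every queue
    state.\<close>
  have "greedy_policy S V \<in> argmin_T S V"
    using min_cost_le[OF system] rules_mono[OF actions_subset_idle_actions, of S]
    by (auto simp: argmin_T_def is_arg_min_def greedy_policy_in_rules[OF system]
        greedy_policy_attains_min_cost[OF system] not_less)
  then show "argmin_T S V \<noteq> {}" by blast
  show char: "\<Omega> \<in> argmin_T S V \<longleftrightarrow>
      (\<forall>Q\<in>qstates S. \<Omega> Q \<in> rules S actions \<and>
        (AE H in csi_law S. \<forall>k n.
          tx_power (\<Omega> Q H) k n = sc_alloc (\<Omega> Q H) k n * water_fill S V Q H k n \<and>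
          (sc_alloc (\<Omega> Q H) k n = 1 \<longrightarrow> X_metric S V Q H k n = X_max S V Q H n)))"
    by (simp add: argmin_T_def is_arg_min_actions_iff[OF system])
  assume indep: "csi_indep_users S"
  show "\<Omega> \<in> argmin_T S V \<longleftrightarrow>
      (\<forall>Q\<in>qstates S. \<Omega> Q \<in> rules S actions \<and>
        (AE H in csi_law S. \<forall>k n.
          tx_power (\<Omega> Q H) k n = sc_alloc (\<Omega> Q H) k n * water_fill S V Q H k n \<and>
          (0 < X_max S V Q H n \<longrightarrow> sc_alloc (\<Omega> Q H) k n = alloc_formula S V Q H k n)))"
    unfolding char using AE_optimal_iff_alloc_formula[OF system indep] by blast
  fix Q assume Q: "Q \<in> qstates S"
  \<comment> \<open>Both sides equal \<open>min_cost\<close>, so permission to idle does not lower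
    the optimum.\<close>
  show "bellman_objective S V Q (formula_policy S V Q) = bellman_T S V Q"
    using formula_policy_attains_min_cost[OF system indep Q] bellman_T_eq_min_cost[OF system Q] by simp
  show "is_arg_min (bellman_objective S V Q) (\<lambda>u. u \<in> rules S idle_actions) (formula_policy S V Q)"
    using min_cost_le[OF system _ Q] formula_policy_in_rules[OF system indep]
    by (auto simp: is_arg_min_def formula_policy_attains_min_cost[OF system indep Q] not_less)
qed

end
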